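(* Let $R:T\to T$ be a linear map with adjoint $R^*:T\to T$ for the inner product $\langle\cdot,\cdot\rangle$. The identity $$(R\otimes\mathrm{id})\,\Delta=\Delta R$$ is equivalent to having $$R^*(\sigma\star\tau)=\sigma\star(R^*\tau)\qquad\text{for all }\sigma\in T_+\text{ and }\tau\in T.$$
   Context: **Decorated trees.** Fix integers $d,n_0,k_0\ge 1$, a finite set of noise types $\mathfrak{T}^-=\{\mathfrak{t}^-_1,\dots,\mathfrak{t}^-_{n_0}\}$ and a finite set of operator types $\mathfrak{T}^+=\{\mathfrak{t}_1^+,\dots,\mathfrak{t}_{k_0}^+\}$. Decorated trees are non-planar rooted trees with a decoration $\mathfrak{n}_v\in\mathbb{N}^{d+1}$ at each node $v$, each edge being decorated by an element $(\mathfrak{t},p)$ of $\mathfrak{T}^+\times\mathbb{N}^{d+1}$, and with at most one noise attached to each node. A noise of type $\mathfrak{t}_l^-$ attached to a node (an edge of noise type leading directly to a leaf) is denoted by the symbol $\zeta_l$, $1\le l\le n_0$; the leaf of a noise edge is not counted as a node of the tree. By convention $\zeta_0=\mathbf{1}$ (no noise). Write $N_\tau$ for the node set of $\tau$. For $a\in\mathfrak{T}^+\times\mathbb{N}^{d+1}$, $\mathcal{I}_a(\tau)$ is the tree obtained by grafting $\tau$ onto a new undecorated root via an edge decorated by $a$; $X^k$ is the single node decorated by $k$; $X^0=\mathbf{1}$. Every decorated tree has a unique decomposition (up to reordering) $\tau=X^k\zeta_l\prod_{j=1}^n\mathcal{I}_{a_j}(\tau_j)$ with $0\le l\le n_0$,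 $a_j\in\mathfrak{T}^+\times\mathbb{N}^{d+1}$, the product being the tree product (identification of roots). $T$ is the real linear span of all decorated trees. **Inner product.** Grouping equal factors, $\tau=X^k\zeta_l\prod_{j=1}^m\mathcal{I}_{a_j}(\tau_j)^{\beta_j}$ with $(a_i,\tau_i)\ne(a_j,\tau_j)$ for $i\neq j$, set inductively $S(\tau)=k!\prod_{j=1}^mS(\tau_j)^{\beta_j}\beta_j!$. The inner product on $T$ is $\langle\sigma,\tau\rangle:=S(\tau)\mathbf{1}_{\sigma=\tau}$ on trees, and $\langle\sigma_1\otimes\sigma_2,\tau_1\otimes\tau_2\rangle:=\langle\sigma_1,\tau_1\rangle\langle\sigma_2,\tau_2\rangle$. The adjoint $R^*:T\to T$ of a linear map $R:T\to T$ is characterised by $\langle R^*\sigma,\tau\rangle=\langle\sigma,R\tau\rangle$ for all $\sigma,\tau\in T$ (it is assumed to exist as a map from $T$ to $T$). **Degree and $T_+$.** Fix a scaling $\mathfrak{s}\in\mathbb{N}^{d+1}$ with positive entries and a map $|\cdot|_{\mathfrak{s}}:\mathfrak{T}^-\cup\mathfrak{T}^+\to\mathbb{R}$ negative on $\mathfrak{T}^-$ and positive on $\mathfrak{T}^+$; set $|p|_{\mathfrak s}=\sum_i\mathfrak{s}_ip_i$. The degree $\deg(\tau)$ is the sum of $|\mathfrak{n}_v|_{\mathfrak{s}}$ over nodes $v$, of $|\mathfrak{t}|_{\mathfrak s}-|p|_{\mathfrak s}$ over edges decorated by $(\mathfrak{t},p)$, and of $|\mathfrak{t}_l^-|_{\mathfrak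 s}$ over the noises $\zeta_l$ ($l\ge1$) of $\tau$. $T_+$ (also written $T^+$) is the linear span of trees of the form $X^k\prod_{i=1}^n\mathcal{I}_{a_i}(\tau_i)$ with $k\in\mathbb{N}^{d+1}$ and $\deg(\mathcal{I}_{a_i}(\tau_i))>0$ for all $i$. **Product $\star$.** For $a=(\mathfrak{t},p)$ and $m\in\mathbb{N}^{d+1}$ write $a-m=(\mathfrak{t},p-m)$; a tree having an edge decoration $(\mathfrak{t},p-m)$ with $p-m\notin\mathbb{N}^{d+1}$ is set to $0$. For decorated trees $\sigma_1,\dots,\sigma_n,\tau$ and $a_i\in\mathfrak{T}^+\times\mathbb{N}^{d+1}$, $$\prod_{i=1}^n\mathcal{I}_{a_i}(\sigma_i)\curvearrowright\tau:=\sum_{v_1,\dots,v_n\in N_\tau}\ \sum_{m_1,\dots,m_n\in\mathbb{N}^{d+1}}\ \prod_{v\in N_\tau}\frac{\mathfrak{n}_v!}{\big(\mathfrak{n}_v-\sum_{i:v_i=v}m_i\big)!\prod_{i:v_i=v}m_i!}\ \tau_{v,m},$$ where $\tau_{v,m}$ is obtained from $\tau$ by replacing the decoration $\mathfrak{n}_v$ of each node $v$ of $\tau$ by $\mathfrak{n}_v-\sum_{i:v_i=v}m_i$ and grafting each $\sigma_i$ onto the node $v_i$ with an edge decorated by $a_i-m_i$ (terms with $\sum_{i:v_i=v}m_i\not\le\mathfrak{n}_v$ for some $v$ are zero). For $B\subset N_\tau$, $\uparrow_B^k:=\prod_{r=1}^{d+1}\big(\sum_{v\in B}\uparrow_v^{e_r}\big)^{k_r}$,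 where $\uparrow_v^{e_r}$ adds $e_r$ to the decoration at $v$ and $(e_r)$ is the canonical basis of $\mathbb{N}^{d+1}$. For $\sigma=X^k\prod_i\mathcal{I}_{a_i}(\sigma_i)$ with $a_i\in\mathfrak{T}^+\times\mathbb{N}^{d+1}$, $$\sigma\star\tau:=\ \uparrow^k_{N_\tau}\Big(\prod_i\mathcal{I}_{a_i}(\sigma_i)\curvearrowright\tau\Big),$$ where $\uparrow^k_{N_\tau}$ acts only on the nodes coming from $\tau$; extended bilinearly. **Splitting map.** $\Delta:T\to T\otimes T_+$ is the linear map (Hairer's co-action) characterised by the duality relation $$\langle\sigma\star\tau,\mu\rangle=\langle\tau\otimes\sigma,\Delta\mu\rangle\qquad\text{for all }\sigma\in T_+,\ \tau,\mu\in T.$$ *)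

theory Defs
  imports "HOL-Analysis.Analysis" "HOL-Library.Poly_Mapping"
begin

section \<open>Linear spans of sets of generators\<close>

text \<open>
  The free real vector space on \<open>'a\<close> is \<open>'a \<Rightarrow>\<^sub>0 real\<close>, with basis the vectors
  \<open>Poly_Mapping.single x 1\<close>. The tensor product of the free spaces on \<open>'a\<close> and \<open>'b\<close> is
  the free space on \<open>'a \<times> 'b\<close>.
\<close>

instantiation poly_mapping :: (type, real_vector) real_vector
begin

lift_definition scaleR_poly_mapping :: "real \<Rightarrow> ('a \<Rightarrow>\<^sub>0 'b) \<Rightarrow> ('a \<Rightarrow>\<^sub>0 'b)"
  is "\<lambda>c f x. c *\<^sub>R f x"
  by (rule finite_subset[rotated]) auto

instance
  by (standard; transfer; simp add: fun_eq_iff scaleR_add_right scaleR_add_left)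

end

abbreviation basis_vec :: "'a \<Rightarrow> ('a \<Rightarrow>\<^sub>0 real)" where
  "basis_vec x \<equiv> Poly_Mapping.single x 1"

definition lin_ext :: "('a \<Rightarrow> 'v::real_vector) \<Rightarrow> ('a \<Rightarrow>\<^sub>0 real) \<Rightarrow> 'v" where
  "lin_ext h f = (\<Sum>x\<in>Poly_Mapping.keys f. Poly_Mapping.lookup f x *\<^sub>R h x)"

definition bilin_ext :: "('a \<Rightarrow> 'b \<Rightarrow> 'v::real_vector) \<Rightarrow> ('a \<Rightarrow>\<^sub>0 real) \<Rightarrow> ('b \<Rightarrow>\<^sub>0 real) \<Rightarrow> 'v" where
  "bilin_ext h f g = lin_ext (\<lambda>x. lin_ext (h x) g) f"

definition tensor :: "('a \<Rightarrow>\<^sub>0 real) \<Rightarrow> ('b \<Rightarrow>\<^sub>0 real) \<Rightarrow> ('a \<times> 'b \<Rightarrow>\<^sub>0 real)" (infixr "\<otimes>\<^sub>T" 75) where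
  "tensor = bilin_ext (\<lambda>x y. basis_vec (x, y))"

definition tensor_map ::
  "(('a \<Rightarrow>\<^sub>0 real) \<Rightarrow> ('c \<Rightarrow>\<^sub>0 real)) \<Rightarrow> (('b \<Rightarrow>\<^sub>0 real) \<Rightarrow> ('d \<Rightarrow>\<^sub>0 real)) \<Rightarrow>
   ('a \<times> 'b \<Rightarrow>\<^sub>0 real) \<Rightarrow> ('c \<times> 'd \<Rightarrow>\<^sub>0 real)" where
  "tensor_map P Q = lin_ext (\<lambda>(x, y). P (basis_vec x) \<otimes>\<^sub>T Q (basis_vec y))"


section \<open>Decorated trees\<close>

text \<open>
  Non-planar rooted trees whose nodes carry an element of \<open>'v\<close> and at most one noise of type
  \<open>'n\<close>, and whose edges are decorated by \<open>'e\<close>: \<open>Node v l M\<close> has root decoration \<open>v\<close>, root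
  noise \<open>l\<close> (\<open>None\<close> for the convention that the noise with index 0 is trivial), and one branch
  per element of the multiset \<open>M\<close>.
\<close>

datatype (nodes: 'v, dead 'n, dead 'e) rtree =
  Node 'v "'n option" "('e \<times> ('v, 'n, 'e) rtree) multiset"
for map: map_nodes

text \<open>
  Multi-indices are elements of \<open>nat ^ 'i\<close>, where the finite type \<open>'i\<close> plays the role of
  \<open>{1..d+1}\<close>. The finite types \<open>'n\<close> and \<open>'k\<close> are the noise types and the operator types.
\<close>

type_synonym ('i, 'n, 'k) dtree = "(nat ^ 'i, 'n, 'k \<times> (nat ^ 'i)) rtree"

type_synonym ('i, 'n, 'k) T = "('i, 'n, 'k) dtree \<Rightarrow>\<^sub>0 real"

lemma size_branch [termination_simp]:
  assumes "(a, s) \<in># M"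
  shows "size s < Suc (n + size_multiset (\<lambda>x. Suc (size (snd x))) M)"
proof -
  obtain M' where "M = add_mset (a, s) M'"
    using assms by (metis insert_DiffM)
  then show ?thesis
    by simp
qed

definition mfact :: "nat ^ 'i \<Rightarrow> real" where
  "mfact k = (\<Prod>r\<in>UNIV. fact (k $ r))"

fun sym_factor :: "('i::finite, 'n, 'k) dtree \<Rightarrow> real" where
  "sym_factor (Node k l M) =
     mfact k * (\<Prod>(a, s)\<in>set_mset M. sym_factor s ^ count M (a, s) * fact (count M (a, s)))"

definition inner_T :: "('i::finite, 'n, 'k) T \<Rightarrow> ('i, 'n, 'k) T \<Rightarrow> real" where
  "inner_T = bilin_ext (\<lambda>\<sigma> \<tau>. if \<sigma> = \<tau> then sym_factor \<tau> else 0)"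

definition inner_TT :: "(('i::finite, 'n, 'k) dtree \<times> ('i, 'n, 'k) dtree \<Rightarrow>\<^sub>0 real) \<Rightarrow>
    (('i, 'n, 'k) dtree \<times> ('i, 'n, 'k) dtree \<Rightarrow>\<^sub>0 real) \<Rightarrow> real" where
  "inner_TT = bilin_ext (\<lambda>(\<sigma>\<^sub>1, \<sigma>\<^sub>2) (\<tau>\<^sub>1, \<tau>\<^sub>2).
     inner_T (basis_vec \<sigma>\<^sub>1) (basis_vec \<tau>\<^sub>1) * inner_T (basis_vec \<sigma>\<^sub>2) (basis_vec \<tau>\<^sub>2))"

definition is_adjoint ::
  "(('i::finite, 'n, 'k) T \<Rightarrow> ('i, 'n, 'k) T) \<Rightarrow> (('i, 'n, 'k) T \<Rightarrow> ('i, 'n, 'k) T) \<Rightarrow> bool" where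
  "is_adjoint R' R \<longleftrightarrow> (\<forall>\<sigma> \<tau>. inner_T (R' \<sigma>) \<tau> = inner_T \<sigma> (R \<tau>))"


section \<open>Degree and positive trees\<close>

definition scaled :: "nat ^ 'i \<Rightarrow> nat ^ 'i \<Rightarrow> real" where
  "scaled \<ss> p = (\<Sum>r\<in>UNIV. real (\<ss> $ r) * real (p $ r))"

text \<open>The maps \<open>\<nu>\<close> and \<open>\<kappa>\<close> are the restrictions of the degree map to noise types and to
  operator types.\<close>

fun tree_deg :: "nat ^ 'i \<Rightarrow> ('n \<Rightarrow> real) \<Rightarrow> ('k \<Rightarrow> real) \<Rightarrow> ('i, 'n, 'k) dtree \<Rightarrow> real" where
  "tree_deg \<ss> \<nu> \<kappa> (Node k l M) =
     scaled \<ss> k + (case l of None \<Rightarrow> 0 | Some j \<Rightarrow> \<nu> j) +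
     (\<Sum>(a, s)\<in>#M. \<kappa> (fst a) - scaled \<ss> (snd a) + tree_deg \<ss> \<nu> \<kappa> s)"

definition planted :: "'k \<times> (nat ^ 'i) \<Rightarrow> ('i, 'n, 'k) dtree \<Rightarrow> ('i, 'n, 'k) dtree" where
  "planted a \<tau> = Node 0 None {#(a, \<tau>)#}"

definition plus_trees ::
  "nat ^ 'i \<Rightarrow> ('n \<Rightarrow> real) \<Rightarrow> ('k \<Rightarrow> real) \<Rightarrow> ('i, 'n, 'k) dtree set" where
  "plus_trees \<ss> \<nu> \<kappa> = {Node k None M | k M. \<forall>(a, s)\<in>#M. tree_deg \<ss> \<nu> \<kappa> (planted a s) > 0}"

definition T_plus :: "nat ^ 'i \<Rightarrow> ('n \<Rightarrow> real) \<Rightarrow> ('k \<Rightarrow> real) \<Rightarrow> ('i, 'n, 'k) T set" where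
  "T_plus \<ss> \<nu> \<kappa> = span (basis_vec ` plus_trees \<ss> \<nu> \<kappa>)"

definition T_tensor_T_plus :: "nat ^ 'i \<Rightarrow> ('n \<Rightarrow> real) \<Rightarrow> ('k \<Rightarrow> real) \<Rightarrow>
    (('i, 'n, 'k) dtree \<times> ('i, 'n, 'k) dtree \<Rightarrow>\<^sub>0 real) set" where
  "T_tensor_T_plus \<ss> \<nu> \<kappa> = span {\<tau> \<otimes>\<^sub>T \<sigma> | \<tau> \<sigma>. \<sigma> \<in> T_plus \<ss> \<nu> \<kappa>}"


section \<open>The product\<close>

text \<open>
  To speak about individual nodes of a non-planar tree \<open>\<tau>\<close>, its nodes are given distinct names:
  \<open>t\<close> is the tree of names and \<open>\<nn>\<close> maps each name to the decoration of that node. The result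
  of the constructions below does not depend on which names are used.
\<close>

fun node_mset :: "('v, 'n, 'e) rtree \<Rightarrow> 'v multiset" where
  "node_mset (Node v l M) = add_mset v (\<Sum>(a, s)\<in>#M. node_mset s)"

definition naming :: "('v, 'n, 'e) rtree \<Rightarrow> (nat, 'n, 'e) rtree \<Rightarrow> (nat \<Rightarrow> 'v) \<Rightarrow> bool" where
  "naming \<tau> t \<nn> \<longleftrightarrow> map_nodes \<nn> t = \<tau> \<and> (\<forall>v\<in>nodes t. count (node_mset t) v = 1)"

text \<open>\<open>graft \<nn> B t\<close> decorates each node \<open>v\<close> of \<open>t\<close> by \<open>\<nn> v\<close> and adds the branches \<open>B v\<close> at it.\<close>

fun graft :: "('u \<Rightarrow> 'v) \<Rightarrow> ('u \<Rightarrow> ('e \<times> ('v, 'n, 'e) rtree) multiset) \<Rightarrow>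
    ('u, 'n, 'e) rtree \<Rightarrow> ('v, 'n, 'e) rtree" where
  "graft \<nn> B (Node v l M) = Node (\<nn> v) l (image_mset (\<lambda>(a, s). (a, graft \<nn> B s)) M + B v)"

text \<open>
  The operator that raises by \<open>k\<close> over the node set \<open>N\<close>, as an element of the monoid algebra of
  the additive monoid of decorations: the basis element of \<open>h\<close> stands for the shift
  \<open>\<nn> \<mapsto> \<nn> + h\<close>, and multiplication in the algebra is composition.
\<close>

definition raise_op :: "'u set \<Rightarrow> nat ^ 'i \<Rightarrow> (('u \<Rightarrow>\<^sub>0 nat ^ 'i) \<Rightarrow>\<^sub>0 real)" where
  "raise_op N k =
     (\<Prod>r\<in>UNIV. (\<Sum>v\<in>N. basis_vec (Poly_Mapping.single v (axis r 1))) ^ (k $ r))"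

text \<open>
  \<open>xs\<close> lists the branches \<open>(a\<^sub>i, \<sigma>\<^sub>i)\<close> to be grafted, the \<open>i\<close>-th one at the node \<open>v i\<close> with its
  edge decoration lowered by \<open>m i\<close>.
\<close>

definition attached :: "'b list \<Rightarrow> (nat \<Rightarrow> 'u) \<Rightarrow> 'u \<Rightarrow> nat set" where
  "attached xs v u = {i. i < length xs \<and> v i = u}"

text \<open>
  Only the nonzero terms: subtraction on \<open>nat ^ 'i\<close> is truncated, so the conventions setting a
  term to zero become conditions on the index set, which also make it finite.
\<close>

definition graft_index :: "(('k \<times> (nat ^ 'i)) \<times> ('i, 'n, 'k) dtree) list \<Rightarrow>
    'u set \<Rightarrow> ('u \<Rightarrow> nat ^ 'i) \<Rightarrow> ((nat \<Rightarrow> 'u) \<times> (nat \<Rightarrow> nat ^ 'i)) set" where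
  "graft_index xs N \<nn> = {(v, m).
     v \<in> {..<length xs} \<rightarrow>\<^sub>E N \<and> m \<in> {..<length xs} \<rightarrow>\<^sub>E UNIV \<and>
     (\<forall>i<length xs. m i \<le> snd (fst (xs ! i))) \<and>
     (\<forall>u\<in>N. (\<Sum>i\<in>attached xs v u. m i) \<le> \<nn> u)}"

definition graft_coeff :: "'b list \<Rightarrow> 'u set \<Rightarrow> ('u \<Rightarrow> nat ^ 'i) \<Rightarrow>
    (nat \<Rightarrow> 'u) \<Rightarrow> (nat \<Rightarrow> nat ^ 'i) \<Rightarrow> real" where
  "graft_coeff xs N \<nn> v m = (\<Prod>u\<in>N. mfact (\<nn> u) /
     (mfact (\<nn> u - (\<Sum>i\<in>attached xs v u. m i)) * (\<Prod>i\<in>attached xs v u. mfact (m i))))"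

definition branches_at :: "(('k \<times> (nat ^ 'i)) \<times> ('i, 'n, 'k) dtree) list \<Rightarrow>
    (nat \<Rightarrow> 'u) \<Rightarrow> (nat \<Rightarrow> nat ^ 'i) \<Rightarrow> 'u \<Rightarrow> (('k \<times> (nat ^ 'i)) \<times> ('i, 'n, 'k) dtree) multiset" where
  "branches_at xs v m u =
     {#case xs ! i of ((t, p), s) \<Rightarrow> ((t, p - m i), s). i \<in># mset_set (attached xs v u)#}"

definition star_named :: "nat ^ 'i \<Rightarrow> (('k \<times> (nat ^ 'i)) \<times> ('i, 'n, 'k) dtree) list \<Rightarrow>
    ('u, 'n, 'k \<times> (nat ^ 'i)) rtree \<Rightarrow> ('u \<Rightarrow> nat ^ 'i) \<Rightarrow> ('i, 'n, 'k) T" where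
  "star_named k xs t \<nn> = (\<Sum>(v, m)\<in>graft_index xs (nodes t) \<nn>.
     graft_coeff xs (nodes t) \<nn> v m *\<^sub>R
     lin_ext (\<lambda>h. basis_vec (graft
         (\<lambda>u. \<nn> u - (\<Sum>i\<in>attached xs v u. m i) + Poly_Mapping.lookup h u)
         (branches_at xs v m) t))
       (raise_op (nodes t) k))"

text \<open>
  The product is only meaningful when the left factor has no noise at its root; the value 0
  otherwise is a dummy.
\<close>

fun star_tree :: "('i::finite, 'n, 'k) dtree \<Rightarrow> ('i, 'n, 'k) dtree \<Rightarrow> ('i, 'n, 'k) T" where
  "star_tree (Node k None M) \<tau> =
     (let xs = (SOME xs. mset xs = M); (t, \<nn>) = (SOME (t, \<nn>). naming \<tau> t \<nn>)
      in star_named k xs t \<nn>)"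
| "star_tree (Node k (Some l) M) \<tau> = 0"

definition star :: "('i::finite, 'n, 'k) T \<Rightarrow> ('i, 'n, 'k) T \<Rightarrow> ('i, 'n, 'k) T" (infixl "\<star>" 70) where
  "star = bilin_ext star_tree"


section \<open>The splitting map\<close>

definition is_splitting :: "nat ^ 'i \<Rightarrow> ('n \<Rightarrow> real) \<Rightarrow> ('k \<Rightarrow> real) \<Rightarrow>
    (('i, 'n, 'k) T \<Rightarrow> (('i, 'n, 'k) dtree \<times> ('i, 'n, 'k) dtree \<Rightarrow>\<^sub>0 real)) \<Rightarrow> bool" where
  "is_splitting \<ss> \<nu> \<kappa> D \<longleftrightarrow> linear D \<and> (\<forall>\<mu>. D \<mu> \<in> T_tensor_T_plus \<ss> \<nu> \<kappa>) \<and>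
     (\<forall>\<sigma>\<in>T_plus \<ss> \<nu> \<kappa>. \<forall>\<tau> \<mu>. inner_T (\<sigma> \<star> \<tau>) \<mu> = inner_TT (\<tau> \<otimes>\<^sub>T \<sigma>) (D \<mu>))"

definition splitting :: "nat ^ 'i \<Rightarrow> ('n \<Rightarrow> real) \<Rightarrow> ('k \<Rightarrow> real) \<Rightarrow>
    ('i, 'n, 'k) T \<Rightarrow> (('i, 'n, 'k) dtree \<times> ('i, 'n, 'k) dtree \<Rightarrow>\<^sub>0 real)" where
  "splitting \<ss> \<nu> \<kappa> = (THE D. is_splitting \<ss> \<nu> \<kappa> D)"


section \<open>Existence and uniqueness of the splitting map\<close>

lemma lookup_scaleR [simp]:
  "Poly_Mapping.lookup (c *\<^sub>R f) x = c *\<^sub>R Poly_Mapping.lookup f x"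
  by transfer simp

lemma lookup_sum': "Poly_Mapping.lookup (sum f A) x = (\<Sum>a\<in>A. Poly_Mapping.lookup (f a) x)"
  by (induction A rule: infinite_finite_induct) (auto simp: lookup_add)

lemma lin_ext_superset:
  assumes "finite A" "Poly_Mapping.keys f \<subseteq> A"
  shows "lin_ext h f = (\<Sum>x\<in>A. Poly_Mapping.lookup f x *\<^sub>R h x)"
  unfolding lin_ext_def using assms
  by (intro sum.mono_neutral_left) (auto simp: in_keys_iff)

lemma linear_lin_ext: "linear (lin_ext h)"
proof (rule linearI)
  fix f g :: "'a \<Rightarrow>\<^sub>0 real" and c :: real
  let ?A = "Poly_Mapping.keys f \<union> Poly_Mapping.keys g"
  have "lin_ext h (f + g) = (\<Sum>x\<in>?A. Poly_Mapping.lookup (f + g) x *\<^sub>R h x)"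
    by (rule lin_ext_superset) (auto simp: in_keys_iff lookup_add)
  moreover have "lin_ext h f = (\<Sum>x\<in>?A. Poly_Mapping.lookup f x *\<^sub>R h x)"
    by (rule lin_ext_superset) auto
  moreover have "lin_ext h g = (\<Sum>x\<in>?A. Poly_Mapping.lookup g x *\<^sub>R h x)"
    by (rule lin_ext_superset) auto
  ultimately show "lin_ext h (f + g) = lin_ext h f + lin_ext h g"
    by (simp add: lookup_add scaleR_add_left sum.distrib)
  have "lin_ext h (c *\<^sub>R f) = (\<Sum>x\<in>Poly_Mapping.keys f. Poly_Mapping.lookup (c *\<^sub>R f) x *\<^sub>R h x)"
    by (rule lin_ext_superset) (auto simp: in_keys_iff)
  then show "lin_ext h (c *\<^sub>R f) = c *\<^sub>R lin_ext h f"
    by (simp add: lin_ext_def scaleR_sum_right)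
qed

lemma lin_ext_basis [simp]: "lin_ext h (basis_vec x) = h x"
  by (simp add: lin_ext_def)

lemma bilin_ext_basis [simp]: "bilin_ext h (basis_vec x) (basis_vec y) = h x y"
  by (simp add: bilin_ext_def)

lemma linear_bilin_ext_left: "linear (\<lambda>f. bilin_ext h f g)"
  unfolding bilin_ext_def by (rule linear_lin_ext)

lemma linear_bilin_ext_right: "linear (bilin_ext h f)"
  unfolding bilin_ext_def lin_ext_def[of _ f]
  by (intro linear_compose_sum ballI linear_compose_scale_right linear_lin_ext)

lemma lin_ext_basis_vec: "lin_ext basis_vec f = f"
proof (rule poly_mapping_eqI)
  fix k
  have "Poly_Mapping.lookup (lin_ext basis_vec f) k =
    (\<Sum>a\<in>Poly_Mapping.keys f. if a = k then Poly_Mapping.lookup f a else 0)"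
    unfolding lin_ext_def lookup_sum' by (intro sum.cong refl) (auto simp: lookup_single)
  then show "Poly_Mapping.lookup (lin_ext basis_vec f) k = Poly_Mapping.lookup f k"
    by (auto simp: in_keys_iff)
qed

lemma lin_ext_linear:
  assumes "linear L"
  shows "L f = lin_ext (\<lambda>x. L (basis_vec x)) f"
proof -
  have "L f = L (lin_ext basis_vec f)"
    by (simp add: lin_ext_basis_vec)
  also have "\<dots> = lin_ext (\<lambda>x. L (basis_vec x)) f"
    unfolding lin_ext_def using assms by (simp add: linear_sum linear_scale)
  finally show ?thesis .
qed

lemma linear_eqI:
  assumes "linear L" "linear L'" "\<And>x. L (basis_vec x) = L' (basis_vec x)"
  shows "L f = L' f"
  using assms by (simp add: lin_ext_linear[of L f] lin_ext_linear[of L' f])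

lemma subspace_keys: "subspace {f :: 'a \<Rightarrow>\<^sub>0 real. Poly_Mapping.keys f \<subseteq> A}"
proof (rule subspaceI)
  fix f g :: "'a \<Rightarrow>\<^sub>0 real" and c :: real
  assume f: "f \<in> {f. Poly_Mapping.keys f \<subseteq> A}"
  have "Poly_Mapping.keys (c *\<^sub>R f) \<subseteq> Poly_Mapping.keys f"
    by (auto simp: in_keys_iff)
  then show "c *\<^sub>R f \<in> {f. Poly_Mapping.keys f \<subseteq> A}"
    using f by blast
  assume "g \<in> {f. Poly_Mapping.keys f \<subseteq> A}"
  then show "f + g \<in> {f. Poly_Mapping.keys f \<subseteq> A}"
    using f Poly_Mapping.keys_add[of f g] by blast
qed simp

lemma span_basis: "span (basis_vec ` A) = {f :: 'a \<Rightarrow>\<^sub>0 real. Poly_Mapping.keys f \<subseteq> A}"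
proof (intro equalityI subsetI)
  fix f :: "'a \<Rightarrow>\<^sub>0 real" assume "f \<in> span (basis_vec ` A)"
  then show "f \<in> {f. Poly_Mapping.keys f \<subseteq> A}"
    using span_minimal[OF _ subspace_keys[of A], of "basis_vec ` A"] by (auto simp: image_subset_iff)
next
  fix f :: "'a \<Rightarrow>\<^sub>0 real" assume "f \<in> {f. Poly_Mapping.keys f \<subseteq> A}"
  then have "lin_ext basis_vec f \<in> span (basis_vec ` A)"
    unfolding lin_ext_def by (intro span_sum span_scale span_base) auto
  then show "f \<in> span (basis_vec ` A)"
    by (simp add: lin_ext_basis_vec)
qed

lemma T_plus_iff: "f \<in> T_plus \<ss> \<nu> \<kappa> \<longleftrightarrow> Poly_Mapping.keys f \<subseteq> plus_trees \<ss> \<nu> \<kappa>"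
  by (simp add: T_plus_def span_basis)

lemma tensor_basis [simp]: "basis_vec x \<otimes>\<^sub>T basis_vec y = basis_vec (x, y)"
  by (simp add: tensor_def)

lemma lookup_tensor:
  "Poly_Mapping.lookup (f \<otimes>\<^sub>T g) (x, y) = Poly_Mapping.lookup f x * Poly_Mapping.lookup g y"
proof -
  have "Poly_Mapping.lookup (f \<otimes>\<^sub>T g) (x, y) =
    (\<Sum>a\<in>Poly_Mapping.keys f. \<Sum>b\<in>Poly_Mapping.keys g. Poly_Mapping.lookup f a *
      (Poly_Mapping.lookup g b * (if a = x \<and> b = y then 1 else 0)))"
    by (simp add: tensor_def bilin_ext_def lin_ext_def lookup_sum' sum_distrib_left lookup_single when_def)
  also have "\<dots> = (\<Sum>a\<in>Poly_Mapping.keys f. if a = x then Poly_Mapping.lookup f a * Poly_Mapping.lookup g y else 0)"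
    by (intro sum.cong refl) (auto simp: if_distrib in_keys_iff sum_distrib_left[symmetric] cong: if_cong)
  also have "\<dots> = Poly_Mapping.lookup f x * Poly_Mapping.lookup g y"
    by (auto simp: in_keys_iff)
  finally show ?thesis .
qed

lemma T_tensor_T_plus_eq:
  "T_tensor_T_plus \<ss> \<nu> \<kappa> = {f. Poly_Mapping.keys f \<subseteq> UNIV \<times> plus_trees \<ss> \<nu> \<kappa>}"
proof -
  have "span {\<tau> \<otimes>\<^sub>T \<sigma> |\<tau> \<sigma>. \<sigma> \<in> T_plus \<ss> \<nu> \<kappa>} = span (basis_vec ` (UNIV \<times> plus_trees \<ss> \<nu> \<kappa>))"
  proof (rule antisym)
    show "span {\<tau> \<otimes>\<^sub>T \<sigma> |\<tau> \<sigma>. \<sigma> \<in> T_plus \<ss> \<nu> \<kappa>} \<subseteq> span (basis_vec ` (UNIV \<times> plus_trees \<ss> \<nu> \<kappa>))"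
      unfolding span_basis by (rule span_minimal[OF _ subspace_keys])
        (auto simp: T_plus_iff in_keys_iff lookup_tensor subset_iff)
    show "span (basis_vec ` (UNIV \<times> plus_trees \<ss> \<nu> \<kappa>)) \<subseteq> span {\<tau> \<otimes>\<^sub>T \<sigma> |\<tau> \<sigma>. \<sigma> \<in> T_plus \<ss> \<nu> \<kappa>}"
    proof (rule span_mono, safe)
      fix x y assume "y \<in> plus_trees \<ss> \<nu> \<kappa>"
      then show "\<exists>\<tau> \<sigma>. basis_vec (x, y) = \<tau> \<otimes>\<^sub>T \<sigma> \<and> \<sigma> \<in> T_plus \<ss> \<nu> \<kappa>"
        by (intro exI[of _ "basis_vec x"] exI[of _ "basis_vec y"]) (simp add: T_plus_iff)
    qed
  qed
  then show ?thesis
    by (simp add: T_tensor_T_plus_def span_basis)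
qed

lemma sym_factor_pos: "sym_factor \<tau> > 0"
proof (induction \<tau> rule: sym_factor.induct)
  case (1 k l M)
  have "mfact k > 0"
    unfolding mfact_def by (intro prod_pos) simp
  moreover have "(\<Prod>(a, s)\<in>set_mset M. sym_factor s ^ count M (a, s) * fact (count M (a, s))) > 0"
  proof (rule prod_pos)
    fix x assume x: "x \<in># M"
    obtain a s where as: "x = (a, s)" by (cases x)
    have "sym_factor s > 0" using 1 x as by blast
    then show "0 < (case x of (a, s) \<Rightarrow> sym_factor s ^ count M (a, s) * fact (count M (a, s)))"
      by (simp add: as)
  qed
  ultimately show ?case by simp
qed

lemma inner_T_basis: "inner_T f (basis_vec \<tau>) = Poly_Mapping.lookup f \<tau> * sym_factor \<tau>"
proof -
  have "inner_T f (basis_vec \<tau>) =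
    (\<Sum>a\<in>Poly_Mapping.keys f. if a = \<tau> then Poly_Mapping.lookup f a * sym_factor \<tau> else 0)"
    unfolding inner_T_def bilin_ext_def lin_ext_def[of _ f] lin_ext_basis
    by (intro sum.cong refl) auto
  then show ?thesis
    by (auto simp: in_keys_iff)
qed

lemma linear_inner_T_right: "linear (inner_T f)"
  and linear_inner_T_left: "linear (\<lambda>f. inner_T f g)"
  unfolding inner_T_def by (rule linear_bilin_ext_right linear_bilin_ext_left)+

lemma linear_inner_TT_right: "linear (inner_TT f)"
  and linear_inner_TT_left: "linear (\<lambda>f. inner_TT f g)"
  unfolding inner_TT_def by (rule linear_bilin_ext_right linear_bilin_ext_left)+

lemma inner_TT_basis:
  "inner_TT (basis_vec (\<tau>, \<sigma>)) g = Poly_Mapping.lookup g (\<tau>, \<sigma>) * sym_factor \<tau> * sym_factor \<sigma>"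
proof (rule linear_eqI[OF linear_inner_TT_right])
  show "linear (\<lambda>g. Poly_Mapping.lookup g (\<tau>, \<sigma>) * sym_factor \<tau> * sym_factor \<sigma>)"
    by (rule linearI) (auto simp: lookup_add algebra_simps)
  show "inner_TT (basis_vec (\<tau>, \<sigma>)) (basis_vec x) =
     Poly_Mapping.lookup (basis_vec x) (\<tau>, \<sigma>) * sym_factor \<tau> * sym_factor \<sigma>" for x
    by (cases x) (auto simp: inner_TT_def inner_T_def lookup_single when_def)
qed

lemma splitting_map_unique:
  assumes "is_splitting \<ss> \<nu> \<kappa> D" "is_splitting \<ss> \<nu> \<kappa> D'"
  shows "D = D'"
proof (rule ext, rule poly_mapping_eqI)
  fix \<mu> and x :: "('a, 'b, 'c) dtree \<times> ('a, 'b, 'c) dtree"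
  obtain \<tau> \<sigma> where x: "x = (\<tau>, \<sigma>)" by (cases x)
  show "Poly_Mapping.lookup (D \<mu>) x = Poly_Mapping.lookup (D' \<mu>) x"
  proof (cases "\<sigma> \<in> plus_trees \<ss> \<nu> \<kappa>")
    case True
    then have "basis_vec \<sigma> \<in> T_plus \<ss> \<nu> \<kappa>"
      by (simp add: T_plus_iff)
    then have "inner_TT (basis_vec \<tau> \<otimes>\<^sub>T basis_vec \<sigma>) (D \<mu>) = inner_TT (basis_vec \<tau> \<otimes>\<^sub>T basis_vec \<sigma>) (D' \<mu>)"
      using assms unfolding is_splitting_def by metis
    then show ?thesis
      using sym_factor_pos[of \<tau>] sym_factor_pos[of \<sigma>] by (simp add: inner_TT_basis x)
  next
    case False
    then have "x \<notin> Poly_Mapping.keys (D \<mu>)" "x \<notin> Poly_Mapping.keys (D' \<mu>)"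
      using assms unfolding is_splitting_def T_tensor_T_plus_eq x by blast+
    then show ?thesis
      by (simp add: in_keys_iff)
  qed
qed

definition msize :: "nat ^ 'i \<Rightarrow> nat" where "msize k = (\<Sum>r\<in>UNIV. k $ r)"

lemma msize_0 [simp]: "msize 0 = 0" and msize_add: "msize (a + b) = msize a + msize b"
  by (auto simp: msize_def sum.distrib)

lemma msize_sum: "msize (sum f A) = (\<Sum>a\<in>A. msize (f a))"
  by (induction A rule: infinite_finite_induct) (auto simp: msize_add)

lemma msize_diff: "a \<le> b \<Longrightarrow> msize (b - a) + msize a = msize b"
  unfolding msize_def sum.distrib[symmetric]
  by (intro sum.cong refl) (auto simp: less_eq_vec_def)

lemma finite_msize: "finite {k :: nat ^ 'i. msize k \<le> W}"
proof -
  have "{k :: nat ^ 'i. msize k \<le> W} \<subseteq> (\<lambda>f. \<chi> r. f r) ` (UNIV \<rightarrow>\<^sub>E {..W})"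
  proof
    fix k :: "nat ^ 'i" assume k: "k \<in> {k. msize k \<le> W}"
    have "k $ r \<le> W" for r
      using k member_le_sum[of r UNIV "\<lambda>r. k $ r"] by (simp add: msize_def)
    then show "k \<in> (\<lambda>f. \<chi> r. f r) ` (UNIV \<rightarrow>\<^sub>E {..W})"
      by (intro image_eqI[of _ _ "\<lambda>r. k $ r"]) auto
  qed
  then show ?thesis
    by (rule finite_subset) (intro finite_imageI finite_PiE; simp)
qed

text \<open>
  Number of nodes plus the sum of all components of all node and edge decorations; only finitely
  many trees lie below any given weight.
\<close>

fun weight :: "('i::finite, 'n, 'k) dtree \<Rightarrow> nat" where
  "weight (Node k l M) = Suc (msize k) + (\<Sum>(a, s)\<in>#M. msize (snd a) + weight s)"

fun edge_weight :: "('u, 'n, 'k \<times> (nat ^ 'i::finite)) rtree \<Rightarrow> nat" where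
  "edge_weight (Node k l M) = (\<Sum>(a, s)\<in>#M. msize (snd a) + edge_weight s)"

lemma weight_pos: "weight \<tau> \<ge> Suc 0" by (cases \<tau>) auto

lemma member_le_sum_mset: "x \<in># M \<Longrightarrow> f x \<le> (\<Sum>y\<in>#M. f y :: nat)"
  by (metis le_add1 insert_DiffM image_mset_add_mset sum_mset.insert)

lemma size_le_sum_mset: "(\<And>x. x \<in># M \<Longrightarrow> f x \<ge> Suc 0) \<Longrightarrow> size M \<le> (\<Sum>y\<in>#M. f y :: nat)"
proof (induction M)
  case (add x M)
  have "Suc 0 \<le> f x" "size M \<le> (\<Sum>y\<in>#M. f y)"
    using add by auto
  then show ?case by simp
qed simp

lemma finite_weight: "finite {\<tau> :: ('i::finite, 'n::finite, 'k::finite) dtree. weight \<tau> \<le> W}"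
proof (induction W)
  case 0
  have "{\<tau> :: ('i, 'n, 'k) dtree. weight \<tau> \<le> 0} = {}"
  proof (intro equals0I)
    fix \<tau> :: "('i, 'n, 'k) dtree" assume "\<tau> \<in> {\<tau>. weight \<tau> \<le> 0}"
    then show False using weight_pos[of \<tau>] by simp
  qed
  then show ?case by (simp only: finite.emptyI)
next
  case (Suc W)
  let ?A = "((UNIV :: 'k set) \<times> {k :: nat ^ 'i. msize k \<le> W}) \<times> {\<tau> :: ('i, 'n, 'k) dtree. weight \<tau> \<le> W}"
  let ?B = "\<Union>n\<le>W. multisets_of_size ?A n"
  have "finite ?B"
    using Suc finite_msize by (intro finite_UN_I finite_multisets_of_size finite_cartesian_product) auto
  moreover have "{\<tau> :: ('i, 'n, 'k) dtree. weight \<tau> \<le> Suc W} \<subseteq>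
    (\<lambda>(k, l, M). Node k l M) ` ({k. msize k \<le> W} \<times> UNIV \<times> ?B)"
  proof
    fix \<tau> :: "('i, 'n, 'k) dtree" assume *: "\<tau> \<in> {\<tau>. weight \<tau> \<le> Suc W}"
    obtain k l M where \<tau>: "\<tau> = Node k l M" by (cases \<tau>)
    have s: "(\<Sum>(a, s)\<in>#M. msize (snd a) + weight s) \<le> W" "msize k \<le> W"
      using * by (auto simp: \<tau>)
    have "size M \<le> W"
    proof -
      have "Suc 0 \<le> (case x of (a, s) \<Rightarrow> msize (snd a) + weight s)" for x :: "('k \<times> (nat ^ 'i)) \<times> ('i, 'n, 'k) dtree"
        using weight_pos[of "snd x"] by (simp add: case_prod_unfold)
      then show ?thesis
        by (rule order_trans[OF size_le_sum_mset s(1)])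
    qed
    moreover have "set_mset M \<subseteq> ?A"
    proof safe
      fix a b s assume "((a, b), s) \<in># M"
      from member_le_sum_mset[OF this, of "\<lambda>(a, s). msize (snd a) + weight s"] s(1)
      show "msize b \<le> W" "weight s \<le> W" by auto
    qed auto
    ultimately have "M \<in> ?B"
      unfolding multisets_of_size_def by blast
    then show "\<tau> \<in> (\<lambda>(k, l, M). Node k l M) ` ({k. msize k \<le> W} \<times> UNIV \<times> ?B)"
      using s(2) by (intro image_eqI[of _ _ "(k, l, M)"]) (auto simp: \<tau>)
  qed
  moreover have "finite ((\<lambda>(k, l, M). Node k l M) ` ({k :: nat ^ 'i. msize k \<le> W} \<times> (UNIV :: 'n option set) \<times> ?B))"
    by (intro finite_imageI finite_cartesian_product finite_msize \<open>finite ?B\<close> finite)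
  ultimately show ?case
    by (meson finite_subset)
qed

lemma set_node_mset: "set_mset (node_mset t) = nodes t"
proof (induction t rule: node_mset.induct)
  case (1 v l M)
  have "set_mset (case x of (a, s) \<Rightarrow> node_mset s) = nodes (snd x)" if "x \<in># M" for x
    using that 1[of x "fst x" "snd x"] by (auto simp: case_prod_unfold)
  then have "(\<Union>x\<in>set_mset M. set_mset (case x of (a, s) \<Rightarrow> node_mset s)) = (\<Union>x\<in>set_mset M. nodes (snd x))"
    by simp
  moreover have "Basic_BNFs.snds x = {snd x}" for x :: "'c \<times> ('a, 'b, 'c) rtree"
    by (cases x) simp
  ultimately show ?case
    by simp
qed

lemma finite_nodes: "finite (nodes t)"
  by (metis finite_set_mset set_node_mset)

lemma map_nodes_graft: "map_nodes f t = graft f (\<lambda>_. {#}) t"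
  by (induction t rule: node_mset.induct) (auto intro!: image_mset_cong)

lemma weight_graft:
  "weight (graft f B t) = (\<Sum>u\<in>#node_mset t. Suc (msize (f u)) +
     (\<Sum>(a, s)\<in>#B u. msize (snd a) + weight s)) + edge_weight t"
proof (induction t rule: node_mset.induct)
  case (1 v l M)
  let ?g = "\<lambda>u. Suc (msize (f u)) + (\<Sum>(a, s)\<in>#B u. msize (snd a) + weight s)"
  have "(\<Sum>(a, s)\<in>#M. msize (snd a) + weight (graft f B s)) =
        (\<Sum>(a, s)\<in>#M. (\<Sum>u\<in>#node_mset s. ?g u) + (msize (snd a) + edge_weight s))"
    by (intro arg_cong[where f = sum_mset] image_mset_cong) (use 1 in auto)
  also have "\<dots> = (\<Sum>(a, s)\<in>#M. (\<Sum>u\<in>#node_mset s. ?g u)) + (\<Sum>(a, s)\<in>#M. msize (snd a) + edge_weight s)"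
    by (simp add: case_prod_unfold sum_mset.distrib)
  also have "(\<Sum>(a, s)\<in>#M. (\<Sum>u\<in>#node_mset s. ?g u)) = (\<Sum>u\<in>#(\<Sum>(a, s)\<in>#M. node_mset s). ?g u)"
    by (induction M) auto
  finally show ?case
    by (simp add: image_mset.compositionality o_def case_prod_unfold)
qed

lemma node_mset_naming: "naming \<tau> t \<nn> \<Longrightarrow> node_mset t = mset_set (nodes t)"
  by (rule multiset_eqI)
    (auto simp: naming_def count_mset_set' finite_nodes count_eq_zero_iff set_node_mset)

lemma keys_raise_sum:
  "h \<in> Poly_Mapping.keys ((\<Sum>v\<in>N. basis_vec (Poly_Mapping.single v (axis r 1))) ^ n) \<Longrightarrow>
   finite N \<Longrightarrow> (\<Sum>v\<in>N. Poly_Mapping.lookup h v) = axis r n"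
proof (induction n arbitrary: h)
  case 0
  then show ?case
    by (auto simp: vec_eq_iff axis_def)
next
  case (Suc n)
  let ?P = "\<Sum>v\<in>N. basis_vec (Poly_Mapping.single v (axis r (1 :: nat)))"
  have "h \<in> Poly_Mapping.keys (?P * ?P ^ n)"
    using Suc.prems by simp
  then obtain a b where h: "h = a + b" and a: "a \<in> Poly_Mapping.keys ?P" and b: "b \<in> Poly_Mapping.keys (?P ^ n)"
    using keys_mult by blast
  have "a \<in> (\<Union>v\<in>N. Poly_Mapping.keys (basis_vec (Poly_Mapping.single v (axis r (1 :: nat)))))"
    using a Poly_Mapping.keys_sum[of "\<lambda>v. basis_vec (Poly_Mapping.single v (axis r (1 :: nat)))" N] by blast
  then obtain v where v: "v \<in> N" "a = Poly_Mapping.single v (axis r 1)"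
    by auto
  have "(\<Sum>u\<in>N. Poly_Mapping.lookup a u) = (\<Sum>u\<in>N. if u = v then axis r 1 else 0)"
    by (intro sum.cong refl) (auto simp: v(2) lookup_single)
  also have "\<dots> = axis r 1"
    using v(1) Suc.prems(2) by simp
  finally show ?case
    using Suc.IH[OF b Suc.prems(2)] by (simp add: h lookup_add sum.distrib) (simp add: vec_eq_iff axis_def)
qed

lemma keys_prod_poly:
  fixes F :: "'r \<Rightarrow> ('m::comm_monoid_add \<Rightarrow>\<^sub>0 real)"
  assumes "finite R" "h \<in> Poly_Mapping.keys (\<Prod>r\<in>R. F r)"
  shows "\<exists>g. (\<forall>r\<in>R. g r \<in> Poly_Mapping.keys (F r)) \<and> h = (\<Sum>r\<in>R. g r)"
  using assms
proof (induction R arbitrary: h rule: finite_induct)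
  case (insert r R)
  then obtain a b where h: "h = a + b" "a \<in> Poly_Mapping.keys (F r)" "b \<in> Poly_Mapping.keys (\<Prod>r\<in>R. F r)"
    using keys_mult[of "F r" "\<Prod>r\<in>R. F r"] by auto
  obtain g where g: "\<forall>r\<in>R. g r \<in> Poly_Mapping.keys (F r)" "b = (\<Sum>r\<in>R. g r)"
    using insert.IH[OF h(3)] by blast
  have "(\<forall>s\<in>insert r R. (g(r := a)) s \<in> Poly_Mapping.keys (F s)) \<and> h = (\<Sum>s\<in>insert r R. (g(r := a)) s)"
  proof -
    have "(\<Sum>s\<in>R. (g(r := a)) s) = (\<Sum>r\<in>R. g r)"
      by (intro sum.cong refl) (use insert.hyps in auto)
    then show ?thesis
      using g h(1,2) insert.hyps by auto
  qed
  then show ?case by blast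
qed simp

lemma keys_raise_op:
  assumes "h \<in> Poly_Mapping.keys (raise_op N k)" "finite N"
  shows "(\<Sum>v\<in>N. Poly_Mapping.lookup h v) = k"
proof -
  obtain g where g: "\<And>r. g r \<in> Poly_Mapping.keys
      ((\<Sum>v\<in>N. basis_vec (Poly_Mapping.single v (axis r (1 :: nat)))) ^ (k $ r))" "h = (\<Sum>r\<in>UNIV. g r)"
    using keys_prod_poly[OF finite assms(1)[unfolded raise_op_def]] by blast
  have "(\<Sum>v\<in>N. Poly_Mapping.lookup h v) = (\<Sum>r\<in>UNIV. \<Sum>v\<in>N. Poly_Mapping.lookup (g r) v)"
    unfolding g(2) lookup_sum by (rule sum.swap)
  also have "\<dots> = (\<Sum>r\<in>UNIV. axis r (k $ r))"
    using keys_raise_sum[OF g(1) assms(2)] by simp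
  also have "\<dots> = k"
    by (simp add: vec_eq_iff axis_def)
  finally show ?thesis .
qed

lemma naming_multiset:
  assumes "\<And>a s b. (a, s) \<in># M \<Longrightarrow> \<exists>t (\<nn> :: nat \<Rightarrow> 'v). map_nodes \<nn> t = s \<and>
     (\<forall>v. count (node_mset t) v \<le> 1) \<and> (\<forall>v\<in>nodes t. b \<le> v)"
  shows "\<exists>M' (\<nn> :: nat \<Rightarrow> 'v). image_mset (\<lambda>(a, s). (a, map_nodes \<nn> s)) M' = M \<and>
     (\<forall>v. count (\<Sum>(a, s)\<in>#M'. node_mset s) v \<le> 1) \<and> (\<forall>(a, s)\<in>#M'. \<forall>v\<in>nodes s. b \<le> v)"
  using assms
proof (induction M)
  case (add x M)
  obtain a s where x: "x = (a, s)" by (cases x)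
  obtain M' and \<nn> :: "nat \<Rightarrow> 'v" where M': "image_mset (\<lambda>(a, s). (a, map_nodes \<nn> s)) M' = M"
     "\<And>v. count (\<Sum>(a, s)\<in>#M'. node_mset s) v \<le> 1" "\<And>a s v. (a, s) \<in># M' \<Longrightarrow> v \<in> nodes s \<Longrightarrow> b \<le> v"
  proof -
    have "\<exists>M' (\<nn> :: nat \<Rightarrow> 'v). image_mset (\<lambda>(a, s). (a, map_nodes \<nn> s)) M' = M \<and>
     (\<forall>v. count (\<Sum>(a, s)\<in>#M'. node_mset s) v \<le> 1) \<and> (\<forall>(a, s)\<in>#M'. \<forall>v\<in>nodes s. b \<le> v)"
    proof (rule add.IH)
      fix a s b assume "(a, s) \<in># M"
      then show "\<exists>t (\<nn> :: nat \<Rightarrow> 'v). map_nodes \<nn> t = s \<and>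
          (\<forall>v. count (node_mset t) v \<le> 1) \<and> (\<forall>v\<in>nodes t. b \<le> v)"
        by (intro add.prems[of a s b]) simp
    qed
    then show ?thesis
      using that by blast
  qed
  define Z where "Z = (\<Sum>(a, s)\<in>#M'. node_mset s)"
  define b' where "b' = Suc (Max (insert b (set_mset Z)))"
  have "x \<le> Max (insert b (set_mset Z))" if "x \<in> insert b (set_mset Z)" for x
    by (rule Max_ge) (use that in auto)
  then have b': "b \<le> b'" "\<And>v. v \<in># (\<Sum>(a, s)\<in>#M'. node_mset s) \<Longrightarrow> v < b'"
    unfolding b'_def Z_def[symmetric] by (auto simp: le_SucI less_Suc_eq_le simp del: Max_insert)
  have lt: "v < b'" if "(a, s) \<in># M'" "v \<in> nodes s" for a s v
    using b'(2)[of v] that by (force simp flip: set_node_mset)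
  obtain t \<nn>' where t: "map_nodes \<nn>' t = s" "\<And>v. count (node_mset t) v \<le> 1" "\<And>v. v \<in> nodes t \<Longrightarrow> b' \<le> v"
    using add.prems[of a s b'] by (auto simp: x)
  let ?n = "\<lambda>v. if v < b' then \<nn> v else \<nn>' v"
  have "map_nodes ?n t = s"
    unfolding t(1)[symmetric] by (rule rtree.map_cong0) (use t(3) in \<open>auto simp: leD\<close>)
  moreover have "image_mset (\<lambda>(a, s). (a, map_nodes ?n s)) M' = M"
    unfolding M'(1)[symmetric]
    by (intro image_mset_cong) (auto intro!: rtree.map_cong0 simp: lt)
  moreover have "count (\<Sum>(a, s)\<in>#add_mset (a, t) M'. node_mset s) v \<le> 1" for v
  proof (cases "v < b'")
    case True
    then have "v \<notin># node_mset t"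
      using t(3)[of v] by (auto simp: set_node_mset)
    then show ?thesis
      using M'(2)[of v] by (simp add: not_in_iff)
  next
    case False
    then have "v \<notin># (\<Sum>(a, s)\<in>#M'. node_mset s)"
      using b'(2)[of v] by blast
    then show ?thesis
      using t(2)[of v] unfolding not_in_iff by simp
  qed
  moreover have "\<forall>(a, s)\<in>#add_mset (a, t) M'. \<forall>v\<in>nodes s. b \<le> v"
    using M'(3) t(3) b'(1) by fastforce
  ultimately show ?case
    by (intro exI[of _ "add_mset (a, t) M'"] exI[of _ ?n]) (auto simp: x)
qed (auto intro: exI[of _ "{#}"])

lemma naming_exists_ge:
  "\<exists>t (\<nn> :: nat \<Rightarrow> 'v). map_nodes \<nn> t = \<tau> \<and> (\<forall>v. count (node_mset t) v \<le> 1) \<and> (\<forall>v\<in>nodes t. b \<le> v)"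
proof (induction \<tau> arbitrary: b rule: node_mset.induct)
  case (1 k l M)
  obtain M' and \<nn> :: "nat \<Rightarrow> 'v" where M': "image_mset (\<lambda>(a, s). (a, map_nodes \<nn> s)) M' = M"
     "\<And>v. count (\<Sum>(a, s)\<in>#M'. node_mset s) v \<le> 1" "\<And>a s v. (a, s) \<in># M' \<Longrightarrow> v \<in> nodes s \<Longrightarrow> Suc b \<le> v"
    using naming_multiset[of M "Suc b"] 1 by fastforce
  have "b \<notin># (\<Sum>(a, s)\<in>#M'. node_mset s)"
    using M'(3) by (fastforce simp: set_node_mset)
  then have c: "count (node_mset (Node b l M')) v \<le> 1" for v
    using M'(2)[of v] unfolding not_in_iff by auto
  have "image_mset (\<lambda>(a, s). (a, map_nodes (\<nn>(b := k)) s)) M' = M"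
    unfolding M'(1)[symmetric]
    by (intro image_mset_cong) (use M'(3) in \<open>fastforce intro!: rtree.map_cong0\<close>)
  then have "map_nodes (\<nn>(b := k)) (Node b l M') = Node k l M"
    by (simp add: map_prod_def)
  moreover have "\<forall>v\<in>nodes (Node b l M'). b \<le> v"
    using M'(3) by (fastforce simp flip: set_node_mset)
  ultimately show ?case
    using c by blast
qed

lemma naming_exists: "\<exists>t \<nn>. naming \<tau> t \<nn>"
proof -
  obtain t and \<nn> :: "nat \<Rightarrow> _" where "map_nodes \<nn> t = \<tau>" "\<And>v. count (node_mset t) v \<le> 1"
    using naming_exists_ge[of \<tau> 0] by blast
  then have "naming \<tau> t \<nn>"
    unfolding naming_def set_node_mset[symmetric] by (metis One_nat_def count_greater_eq_one_iff le_antisym)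
  then show ?thesis by blast
qed

lemma sum_attached:
  assumes "v \<in> {..<length xs} \<rightarrow>\<^sub>E N" "finite N"
  shows "(\<Sum>u\<in>N. \<Sum>i\<in>attached xs v u. g i) = (\<Sum>i<length xs. g i)"
proof -
  have "(\<Sum>i<length xs. g i) = (\<Sum>u\<in>N. sum g {i \<in> {..<length xs}. v i = u})"
    using assms by (intro sum.group[symmetric]) auto
  then show ?thesis
    by (simp add: attached_def)
qed

lemma weight_branches_at:
  assumes "\<forall>i<length xs. m i \<le> snd (fst (xs ! i))"
  shows "(\<Sum>(a, s)\<in>#branches_at xs v m u. msize (snd a) + weight s) + (\<Sum>i\<in>attached xs v u. msize (m i)) =
    (\<Sum>i\<in>attached xs v u. msize (snd (fst (xs ! i))) + weight (snd (xs ! i)))"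
proof -
  have "(\<Sum>(a, s)\<in>#branches_at xs v m u. msize (snd a) + weight s) =
    (\<Sum>i\<in>attached xs v u. msize (snd (fst (xs ! i)) - m i) + weight (snd (xs ! i)))"
    by (simp add: branches_at_def sum_unfold_sum_mset image_mset.compositionality o_def case_prod_unfold)
  also have "\<dots> + (\<Sum>i\<in>attached xs v u. msize (m i)) =
    (\<Sum>i\<in>attached xs v u. (msize (snd (fst (xs ! i)) - m i) + msize (m i)) + weight (snd (xs ! i)))"
    by (simp add: sum.distrib)
  also have "\<dots> = (\<Sum>i\<in>attached xs v u. msize (snd (fst (xs ! i))) + weight (snd (xs ! i)))"
    using assms by (intro sum.cong refl) (auto simp: msize_diff attached_def)
  finally show ?thesis .
qed

lemma sum_list_nth_mset:
  "mset xs = M \<Longrightarrow> (\<Sum>x\<in>#M. f x) = (\<Sum>i<length xs. f (xs ! i) :: nat)"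
proof -
  assume xs: "mset xs = M"
  have "(\<Sum>x\<in>#M. f x) = sum_list (map f xs)"
    unfolding xs[symmetric] by (metis mset_map sum_mset_sum_list)
  then show ?thesis
    by (simp add: sum_list_sum_nth lessThan_atLeast0)
qed

lemma keys_sum_ex: "x \<in> Poly_Mapping.keys (sum b I) \<Longrightarrow> \<exists>i\<in>I. x \<in> Poly_Mapping.keys (b i)"
  using Poly_Mapping.keys_sum[of b I] by blast

lemma star_tree_weight:
  assumes "\<mu> \<in> Poly_Mapping.keys (star_tree (Node k None M) \<tau>)"
  obtains xs m where "mset xs = M" "\<forall>i<length xs. m i \<le> snd (fst (xs ! i))"
    "weight \<mu> + 1 + 2 * (\<Sum>i<length xs. msize (m i)) = weight \<tau> + weight (Node k None M)"
    "(\<Sum>i<length xs. msize (snd (fst (xs ! i))) + weight (snd (xs ! i))) \<le> weight \<mu> + (\<Sum>i<length xs. msize (m i))"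
proof -
  define xs where "xs = (SOME xs. mset xs = M)"
  have xs: "mset xs = M"
    unfolding xs_def by (rule someI_ex) (rule ex_mset)
  obtain t \<nn> where tn: "(t, \<nn>) = (SOME (t, \<nn>). naming \<tau> t \<nn>)"
    by (metis surj_pair)
  have "\<exists>x. case x of (t, \<nn>) \<Rightarrow> naming \<tau> t \<nn>"
    using naming_exists[of \<tau>] by auto
  from someI_ex[OF this] have nam: "naming \<tau> t \<nn>"
    unfolding tn[symmetric] by simp
  let ?N = "nodes t"
  have "\<mu> \<in> Poly_Mapping.keys (star_named k xs t \<nn>)"
    using assms by (simp add: Let_def xs_def flip: tn)
  from keys_sum_ex[OF this[unfolded star_named_def]] obtain v m where vm: "(v, m) \<in> graft_index xs ?N \<nn>" and
    "\<mu> \<in> Poly_Mapping.keys (graft_coeff xs ?N \<nn> v m *\<^sub>R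
     lin_ext (\<lambda>h. basis_vec (graft
         (\<lambda>u. \<nn> u - (\<Sum>i\<in>attached xs v u. m i) + Poly_Mapping.lookup h u)
         (branches_at xs v m) t))
       (raise_op ?N k))"
    by (auto simp: case_prod_unfold)
  then have "\<mu> \<in> Poly_Mapping.keys (lin_ext (\<lambda>h. basis_vec (graft
         (\<lambda>u. \<nn> u - (\<Sum>i\<in>attached xs v u. m i) + Poly_Mapping.lookup h u)
         (branches_at xs v m) t)) (raise_op ?N k))"
    by (auto simp: in_keys_iff)
  from keys_sum_ex[OF this[unfolded lin_ext_def]] obtain h where h: "h \<in> Poly_Mapping.keys (raise_op ?N k)" and
    "\<mu> \<in> Poly_Mapping.keys (Poly_Mapping.lookup (raise_op ?N k) h *\<^sub>R basis_vec (graft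
         (\<lambda>u. \<nn> u - (\<Sum>i\<in>attached xs v u. m i) + Poly_Mapping.lookup h u)
         (branches_at xs v m) t))"
    by blast
  then have \<mu>: "\<mu> = graft (\<lambda>u. \<nn> u - (\<Sum>i\<in>attached xs v u. m i) + Poly_Mapping.lookup h u)
         (branches_at xs v m) t"
    by (auto simp: in_keys_iff lookup_single when_def split: if_splits)
  have fin: "finite ?N"
    by (rule finite_nodes)
  have v: "v \<in> {..<length xs} \<rightarrow>\<^sub>E ?N" and m: "\<forall>i<length xs. m i \<le> snd (fst (xs ! i))"
    and le: "\<And>u. u \<in> ?N \<Longrightarrow> (\<Sum>i\<in>attached xs v u. m i) \<le> \<nn> u"
    using vm by (auto simp: graft_index_def)
  have mset: "(\<Sum>u\<in>#node_mset t. F u) = (\<Sum>u\<in>?N. F u)" for F :: "nat \<Rightarrow> nat"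
    by (simp add: node_mset_naming[OF nam] sum_unfold_sum_mset)
  let ?B = "\<lambda>u. \<Sum>(a, s)\<in>#branches_at xs v m u. msize (snd a) + weight s"
  let ?A = "\<lambda>u. \<Sum>i\<in>attached xs v u. msize (m i)"
  let ?P = "\<lambda>i. msize (snd (fst (xs ! i))) + weight (snd (xs ! i))"
  have w\<tau>: "weight \<tau> = (\<Sum>u\<in>?N. Suc (msize (\<nn> u))) + edge_weight t"
  proof -
    have "\<tau> = graft \<nn> (\<lambda>_. {#}) t"
      using nam by (simp add: naming_def map_nodes_graft)
    then show ?thesis
      by (simp add: weight_graft mset)
  qed
  have w\<mu>: "weight \<mu> = (\<Sum>u\<in>?N. Suc (msize (\<nn> u - (\<Sum>i\<in>attached xs v u. m i) + Poly_Mapping.lookup h u)) + ?B u) + edge_weight t"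
    unfolding \<mu> weight_graft mset ..
  have sumA: "(\<Sum>u\<in>?N. ?A u) = (\<Sum>i<length xs. msize (m i))"
    by (rule sum_attached[OF v fin])
  have sumB: "(\<Sum>u\<in>?N. ?B u) + (\<Sum>u\<in>?N. ?A u) = (\<Sum>i<length xs. ?P i)"
    unfolding sum.distrib[symmetric] weight_branches_at[OF m] by (rule sum_attached[OF v fin])
  have sumk: "(\<Sum>u\<in>?N. msize (Poly_Mapping.lookup h u)) = msize k"
    using keys_raise_op[OF h fin] by (simp flip: msize_sum)
  have "(\<Sum>u\<in>?N. msize (\<nn> u - (\<Sum>i\<in>attached xs v u. m i) + Poly_Mapping.lookup h u)) + (\<Sum>u\<in>?N. ?A u) =
     (\<Sum>u\<in>?N. msize (\<nn> u) + msize (Poly_Mapping.lookup h u))"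
    unfolding sum.distrib[symmetric]
  proof (intro sum.cong refl)
    fix u assume "u \<in> ?N"
    from msize_diff[OF le[OF this]]
    show "msize (\<nn> u - (\<Sum>i\<in>attached xs v u. m i) + Poly_Mapping.lookup h u) + ?A u = msize (\<nn> u) + msize (Poly_Mapping.lookup h u)"
      by (simp add: msize_add msize_sum)
  qed
  then have sumn: "(\<Sum>u\<in>?N. msize (\<nn> u - (\<Sum>i\<in>attached xs v u. m i) + Poly_Mapping.lookup h u)) + (\<Sum>u\<in>?N. ?A u) =
     (\<Sum>u\<in>?N. msize (\<nn> u)) + msize k"
    by (simp add: sum.distrib sumk)
  have w\<sigma>: "weight (Node k None M) = Suc (msize k) + (\<Sum>i<length xs. ?P i)"
    by (simp add: sum_list_nth_mset[OF xs] case_prod_unfold)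
  have w\<mu>': "weight \<mu> = card ?N + (\<Sum>u\<in>?N. msize (\<nn> u - (\<Sum>i\<in>attached xs v u. m i) + Poly_Mapping.lookup h u)) + (\<Sum>u\<in>?N. ?B u) + edge_weight t"
    unfolding w\<mu> sum.distrib Suc_eq_plus1 by simp
  have w\<tau>': "weight \<tau> = card ?N + (\<Sum>u\<in>?N. msize (\<nn> u)) + edge_weight t"
    unfolding w\<tau> sum.distrib Suc_eq_plus1 by simp
  show thesis
  proof (rule that[OF xs])
    show "\<forall>i<length xs. m i \<le> snd (fst (xs ! i))"
      by (rule m)
    show "weight \<mu> + 1 + 2 * (\<Sum>i<length xs. msize (m i)) = weight \<tau> + weight (Node k None M)"
      using sumn sumB unfolding w\<mu>' w\<tau>' w\<sigma> sumA by linarith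
    show "(\<Sum>i<length xs. ?P i) \<le> weight \<mu> + (\<Sum>i<length xs. msize (m i))"
      using sumB unfolding w\<mu>' sumA by linarith
  qed
qed

lemma tree_deg_le:
  assumes "\<And>r. \<ss> $ r \<le> c" "\<And>j. \<nu> j < 0" "\<And>t. \<kappa> t \<le> real c"
  shows "tree_deg \<ss> \<nu> \<kappa> \<tau> + real c \<le> real c * real (weight \<tau>)"
proof (induction \<tau> rule: weight.induct)
  case (1 k l M)
  have "scaled \<ss> k \<le> real c * real (msize k)"
    unfolding scaled_def msize_def of_nat_sum sum_distrib_left
    by (intro sum_mono mult_right_mono) (use assms(1) in auto)
  moreover have "(case l of None \<Rightarrow> 0 | Some j \<Rightarrow> \<nu> j) \<le> 0"
    using assms(2) by (auto split: option.splits intro: less_imp_le)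
  moreover have "(\<Sum>(a, s)\<in>#M. \<kappa> (fst a) - scaled \<ss> (snd a) + tree_deg \<ss> \<nu> \<kappa> s) \<le>
      real c * real (\<Sum>(a, s)\<in>#M. msize (snd a) + weight s)"
    using 1
  proof (induction M)
    case (add x M)
    obtain a s where x: "x = (a, s)" by (cases x)
    have "tree_deg \<ss> \<nu> \<kappa> s + real c \<le> real c * real (weight s)"
      using add.prems[of "(a, s)" a s] by (simp add: x)
    moreover have "scaled \<ss> (snd a) \<ge> 0"
      by (auto simp: scaled_def intro!: sum_nonneg)
    moreover have "real c * real (msize (snd a)) \<ge> 0"
      by simp
    moreover have "(\<Sum>(a, s)\<in>#M. \<kappa> (fst a) - scaled \<ss> (snd a) + tree_deg \<ss> \<nu> \<kappa> s) \<le>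
      real c * real (\<Sum>(a, s)\<in>#M. msize (snd a) + weight s)"
      by (rule add.IH) (rule add.prems, auto)
    moreover have "(\<Sum>(a, s)\<in>#add_mset x M. \<kappa> (fst a) - scaled \<ss> (snd a) + tree_deg \<ss> \<nu> \<kappa> s) =
        \<kappa> (fst a) - scaled \<ss> (snd a) + tree_deg \<ss> \<nu> \<kappa> s +
        (\<Sum>(a, s)\<in>#M. \<kappa> (fst a) - scaled \<ss> (snd a) + tree_deg \<ss> \<nu> \<kappa> s)"
      by (simp add: x)
    moreover have "real c * real (\<Sum>(a, s)\<in>#add_mset x M. msize (snd a) + weight s) =
        real c * real (msize (snd a)) + real c * real (weight s) +
        real c * real (\<Sum>(a, s)\<in>#M. msize (snd a) + weight s)"
      unfolding distrib_left[symmetric] of_nat_add[symmetric] by (simp add: x)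
    ultimately show ?case
      using assms(3)[of "fst a"] by linarith
  qed simp
  ultimately show ?case
    by (simp add: distrib_left)
qed

lemma finite_star_support:
  fixes \<ss> :: "nat ^ 'i::finite" and \<nu> :: "'n::finite \<Rightarrow> real" and \<kappa> :: "'k::finite \<Rightarrow> real"
  assumes "\<And>r. \<ss> $ r > 0" "\<And>j. \<nu> j < 0"
  shows "finite {(\<tau>, \<sigma>). \<sigma> \<in> plus_trees \<ss> \<nu> \<kappa> \<and> Poly_Mapping.lookup (star_tree \<sigma> \<tau>) \<mu> \<noteq> 0}"
proof -
  obtain c :: nat where c: "\<And>r. \<ss> $ r \<le> c" "\<And>t. \<kappa> t \<le> real c"
  proof -
    have "\<ss> $ r \<le> (\<Sum>r\<in>UNIV. \<ss> $ r) + nat \<lceil>\<Sum>t\<in>UNIV. \<bar>\<kappa> t\<bar>\<rceil>" for r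
      using member_le_sum[of r UNIV "\<lambda>r. \<ss> $ r"] by simp
    moreover have "\<kappa> t \<le> real ((\<Sum>r\<in>UNIV. \<ss> $ r) + nat \<lceil>\<Sum>t\<in>UNIV. \<bar>\<kappa> t\<bar>\<rceil>)" for t
    proof -
      have "\<kappa> t \<le> \<bar>\<kappa> t\<bar>" by simp
      also have "\<dots> \<le> (\<Sum>t\<in>UNIV. \<bar>\<kappa> t\<bar>)"
        by (rule member_le_sum) auto
      also have "\<dots> \<le> real (nat \<lceil>\<Sum>t\<in>UNIV. \<bar>\<kappa> t\<bar>\<rceil>)"
        by (rule real_nat_ceiling_ge)
      also have "\<dots> \<le> real ((\<Sum>r\<in>UNIV. \<ss> $ r) + nat \<lceil>\<Sum>t\<in>UNIV. \<bar>\<kappa> t\<bar>\<rceil>)"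
        by (rule of_nat_mono) simp
      finally show ?thesis .
    qed
    ultimately show ?thesis
      by (rule that)
  qed
  define K where "K = weight \<mu> + 1 + 2 * (c * weight \<mu>)"
  have "weight \<tau> + weight \<sigma> \<le> K"
    if \<sigma>: "\<sigma> \<in> plus_trees \<ss> \<nu> \<kappa>" and nz: "Poly_Mapping.lookup (star_tree \<sigma> \<tau>) \<mu> \<noteq> 0" for \<tau> \<sigma>
  proof -
    obtain k M where \<sigma>_eq: "\<sigma> = Node k None M"
      and pos: "\<And>a s. (a, s) \<in># M \<Longrightarrow> tree_deg \<ss> \<nu> \<kappa> (planted a s) > 0"
      using \<sigma> unfolding plus_trees_def by blast
    have edge: "msize (snd a) \<le> c * weight s" if "(a, s) \<in># M" for a s
    proof -
      have "real (msize (snd a)) \<le> scaled \<ss> (snd a)"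
        unfolding msize_def scaled_def of_nat_sum
      proof (rule sum_mono)
        fix r show "real (snd a $ r) \<le> real (\<ss> $ r) * real (snd a $ r)"
          using assms(1)[of r] by (simp add: mult_le_cancel_right1 Suc_le_eq)
      qed
      also have "\<dots> \<le> \<kappa> (fst a) + tree_deg \<ss> \<nu> \<kappa> s"
        using pos[OF that] by (simp add: planted_def scaled_def)
      also have "\<dots> \<le> real (c * weight s)"
        using tree_deg_le[where \<tau> = s and \<nu> = \<nu> and \<kappa> = \<kappa>, OF c(1) assms(2) c(2)] c(2)[of "fst a"] by simp
      finally show ?thesis
        by (simp only: of_nat_le_iff)
    qed
    have "\<mu> \<in> Poly_Mapping.keys (star_tree (Node k None M) \<tau>)"
      using nz by (simp only: in_keys_iff \<sigma>_eq not_False_eq_True)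
    then obtain xs m where xs: "mset xs = M" and m: "\<forall>i<length xs. m i \<le> snd (fst (xs ! i))"
      and eq: "weight \<mu> + 1 + 2 * (\<Sum>i<length xs. msize (m i)) = weight \<tau> + weight (Node k None M)"
      and le: "(\<Sum>i<length xs. msize (snd (fst (xs ! i))) + weight (snd (xs ! i))) \<le> weight \<mu> + (\<Sum>i<length xs. msize (m i))"
      by (rule star_tree_weight)
    have mp: "(\<Sum>i<length xs. msize (m i)) \<le> (\<Sum>i<length xs. msize (snd (fst (xs ! i))))"
    proof (rule sum_mono)
      fix i assume "i \<in> {..<length xs}"
      then show "msize (m i) \<le> msize (snd (fst (xs ! i)))"
        using msize_diff[OF m[rule_format, of i]] by simp
    qed
    have pw: "(\<Sum>i<length xs. msize (snd (fst (xs ! i)))) \<le> c * (\<Sum>i<length xs. weight (snd (xs ! i)))"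
      unfolding sum_distrib_left
    proof (rule sum_mono)
      fix i assume "i \<in> {..<length xs}"
      then have "(fst (xs ! i), snd (xs ! i)) \<in># M"
        using xs by auto
      then show "msize (snd (fst (xs ! i))) \<le> c * weight (snd (xs ! i))"
        by (rule edge)
    qed
    have "(\<Sum>i<length xs. weight (snd (xs ! i))) \<le> weight \<mu>"
      using le mp unfolding sum.distrib by linarith
    then have "c * (\<Sum>i<length xs. weight (snd (xs ! i))) \<le> c * weight \<mu>"
      by (rule mult_le_mono2)
    then show ?thesis
      using eq mp pw unfolding K_def \<sigma>_eq by linarith
  qed
  then have "{(\<tau>, \<sigma>). \<sigma> \<in> plus_trees \<ss> \<nu> \<kappa> \<and> Poly_Mapping.lookup (star_tree \<sigma> \<tau>) \<mu> \<noteq> 0} \<subseteq>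
    {\<tau>. weight \<tau> \<le> K} \<times> {\<sigma>. weight \<sigma> \<le> K}"
    by fastforce
  then show ?thesis
    by (rule finite_subset) (intro finite_cartesian_product finite_weight)
qed

lemma splitting_exists:
  fixes \<ss> :: "nat ^ 'i::finite" and \<nu> :: "'n::finite \<Rightarrow> real" and \<kappa> :: "'k::finite \<Rightarrow> real"
  assumes "\<And>r. \<ss> $ r > 0" "\<And>j. \<nu> j < 0"
  shows "\<exists>D. is_splitting \<ss> \<nu> \<kappa> D"
proof -
  define U where "U \<mu> = {(\<tau>, \<sigma>). \<sigma> \<in> plus_trees \<ss> \<nu> \<kappa> \<and> Poly_Mapping.lookup (star_tree \<sigma> \<tau>) \<mu> \<noteq> 0}" for \<mu>
  define C where "C \<mu> x = Poly_Mapping.lookup (star_tree (snd x) (fst x)) \<mu> * sym_factor \<mu> /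
    (sym_factor (fst x) * sym_factor (snd x))" for \<mu> and x :: "('i, 'n, 'k) dtree \<times> ('i, 'n, 'k) dtree"
  define d where "d \<mu> = (\<Sum>x\<in>U \<mu>. C \<mu> x *\<^sub>R basis_vec x)" for \<mu>
  define D where "D = lin_ext d"
  have finU: "finite (U \<mu>)" for \<mu>
    unfolding U_def using assms by (rule finite_star_support)
  have lin: "linear D"
    unfolding D_def by (rule linear_lin_ext)
  have look: "Poly_Mapping.lookup (d \<mu>) (\<tau>, \<sigma>) = C \<mu> (\<tau>, \<sigma>)" if "\<sigma> \<in> plus_trees \<ss> \<nu> \<kappa>" for \<tau> \<sigma> \<mu>
  proof -
    have "Poly_Mapping.lookup (d \<mu>) (\<tau>, \<sigma>) = (\<Sum>x\<in>U \<mu>. if x = (\<tau>, \<sigma>) then C \<mu> x else 0)"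
      unfolding d_def lookup_sum' by (intro sum.cong refl) (auto simp: lookup_single)
    also have "\<dots> = C \<mu> (\<tau>, \<sigma>)"
      using finU[of \<mu>] that by (auto simp: U_def C_def)
    finally show ?thesis .
  qed
  have "D \<mu> \<in> T_tensor_T_plus \<ss> \<nu> \<kappa>" for \<mu>
  proof -
    have "D \<mu> \<in> span (basis_vec ` (UNIV \<times> plus_trees \<ss> \<nu> \<kappa>))"
      unfolding D_def lin_ext_def d_def
      by (intro span_sum span_scale span_base) (auto simp: U_def)
    then show ?thesis
      by (simp only: span_basis T_tensor_T_plus_eq)
  qed
  moreover have "inner_T (\<sigma> \<star> \<tau>) \<mu> = inner_TT (\<tau> \<otimes>\<^sub>T \<sigma>) (D \<mu>)" if "\<sigma> \<in> T_plus \<ss> \<nu> \<kappa>" for \<sigma> \<tau> \<mu>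
  proof -
    have l1: "linear (\<lambda>\<sigma>. inner_T (\<sigma> \<star> \<tau>) \<mu>)" for \<tau> \<mu>
      using linear_compose[OF linear_bilin_ext_left linear_inner_T_left] unfolding star_def o_def .
    have l2: "linear (\<lambda>\<tau>. inner_T (\<sigma> \<star> \<tau>) \<mu>)" for \<sigma> \<mu>
      using linear_compose[OF linear_bilin_ext_right linear_inner_T_left] unfolding star_def o_def .
    have r1: "linear (\<lambda>\<sigma>. inner_TT (\<tau> \<otimes>\<^sub>T \<sigma>) (D \<mu>))" for \<tau> \<mu>
      using linear_compose[OF linear_bilin_ext_right linear_inner_TT_left] unfolding tensor_def o_def .
    have r2: "linear (\<lambda>\<tau>. inner_TT (\<tau> \<otimes>\<^sub>T \<sigma>) (D \<mu>))" for \<sigma> \<mu>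
      using linear_compose[OF linear_bilin_ext_left linear_inner_TT_left] unfolding tensor_def o_def .
    have r3: "linear (\<lambda>\<mu>. inner_TT x (D \<mu>))" for x
      using linear_compose[OF lin linear_inner_TT_right] unfolding o_def .
    have basis: "inner_T (basis_vec s \<star> basis_vec t) (basis_vec u) = inner_TT (basis_vec t \<otimes>\<^sub>T basis_vec s) (D (basis_vec u))"
      if "s \<in> plus_trees \<ss> \<nu> \<kappa>" for s t u
      using sym_factor_pos[of s] sym_factor_pos[of t]
      by (simp add: star_def inner_T_basis inner_TT_basis D_def look[OF that] C_def)
    have key: "inner_T (basis_vec s \<star> \<tau>) \<mu> = inner_TT (\<tau> \<otimes>\<^sub>T basis_vec s) (D \<mu>)"
      if "s \<in> plus_trees \<ss> \<nu> \<kappa>" for s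
      by (rule linear_eqI[OF l2 r2], rule linear_eqI[OF linear_inner_T_right r3], rule basis[OF that])
    show ?thesis
    proof -
      have "inner_T (\<sigma> \<star> \<tau>) \<mu> = lin_ext (\<lambda>s. inner_T (basis_vec s \<star> \<tau>) \<mu>) \<sigma>"
        by (rule lin_ext_linear[OF l1])
      also have "\<dots> = lin_ext (\<lambda>s. inner_TT (\<tau> \<otimes>\<^sub>T basis_vec s) (D \<mu>)) \<sigma>"
        unfolding lin_ext_def
        by (intro sum.cong refl arg_cong[where f = "scaleR _"] key) (use that in \<open>auto simp: T_plus_iff\<close>)
      also have "\<dots> = inner_TT (\<tau> \<otimes>\<^sub>T \<sigma>) (D \<mu>)"
        by (rule lin_ext_linear[OF r1, symmetric])
      finally show ?thesis .
    qed
  qed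
  ultimately show ?thesis
    unfolding is_splitting_def using lin by blast
qed

lemma is_splitting_splitting:
  fixes \<ss> :: "nat ^ 'i::finite" and \<nu> :: "'n::finite \<Rightarrow> real" and \<kappa> :: "'k::finite \<Rightarrow> real"
  assumes "\<And>r. \<ss> $ r > 0" "\<And>j. \<nu> j < 0"
  shows "is_splitting \<ss> \<nu> \<kappa> (splitting \<ss> \<nu> \<kappa>)"
  unfolding splitting_def
proof (rule theI'[where P = "is_splitting \<ss> \<nu> \<kappa>"])
  show "\<exists>!D. is_splitting \<ss> \<nu> \<kappa> D"
    using splitting_exists[of \<ss> \<nu> \<kappa>, OF assms] splitting_map_unique by blast
qed

end

theory Submission
  imports Defs
begin

text \<open>
  Both identities are tested against the inner product: for \<open>\<sigma>\<close> in \<open>T\<^sub>+\<close>,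
  \<open>\<langle>\<tau> \<otimes> \<sigma>, (R \<otimes> id) (\<Delta> \<mu>)\<rangle> = \<langle>R\<^sup>* \<tau> \<otimes> \<sigma>, \<Delta> \<mu>\<rangle> = \<langle>\<sigma> \<star> R\<^sup>* \<tau>, \<mu>\<rangle>\<close> and
  \<open>\<langle>\<tau> \<otimes> \<sigma>, \<Delta> (R \<mu>)\<rangle> = \<langle>\<sigma> \<star> \<tau>, R \<mu>\<rangle> = \<langle>R\<^sup>* (\<sigma> \<star> \<tau>), \<mu>\<rangle>\<close>. The inner products are
  nondegenerate, and both \<open>(R \<otimes> id) \<Delta>\<close> and \<open>\<Delta> R\<close> take values in \<open>T \<otimes> T\<^sub>+\<close>, so it is enough
  to pair with \<open>\<sigma>\<close> in \<open>T\<^sub>+\<close>.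
\<close>

text \<open>Pairing with a tree returns its coefficient times its symmetry factor, which is positive
  and can be cancelled.\<close>

lemma inner_T_nondegenerate:
  assumes "\<And>\<mu>. inner_T f \<mu> = inner_T g \<mu>"
  shows "f = g"
proof (rule poly_mapping_eqI)
  fix \<tau>
  show "Poly_Mapping.lookup f \<tau> = Poly_Mapping.lookup g \<tau>"
    using assms[of "basis_vec \<tau>"] sym_factor_pos[of \<tau>] by (simp add: inner_T_basis)
qed

text \<open>Pairing with tree pairs recovers, up to positive symmetry factors, the coefficients
  whose second tree lies in \<open>plus_trees\<close>; all other coefficients vanish for both
  \<open>x\<close> and \<open>y\<close>.\<close>

lemma inner_TT_nondegenerate_plus:
  assumes "x \<in> T_tensor_T_plus \<ss> \<nu> \<kappa>" "y \<in> T_tensor_T_plus \<ss> \<nu> \<kappa>"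
    and "\<And>\<sigma> \<tau>. \<sigma> \<in> T_plus \<ss> \<nu> \<kappa> \<Longrightarrow> inner_TT (\<tau> \<otimes>\<^sub>T \<sigma>) x = inner_TT (\<tau> \<otimes>\<^sub>T \<sigma>) y"
  shows "x = y"
proof (rule poly_mapping_eqI)
  fix z :: "('a, 'b, 'c) dtree \<times> ('a, 'b, 'c) dtree"
  obtain \<tau> \<sigma> where z: "z = (\<tau>, \<sigma>)" by (cases z)
  show "Poly_Mapping.lookup x z = Poly_Mapping.lookup y z"
  proof (cases "\<sigma> \<in> plus_trees \<ss> \<nu> \<kappa>")
    case True
    then have "basis_vec \<sigma> \<in> T_plus \<ss> \<nu> \<kappa>"
      by (simp add: T_plus_iff)
    from assms(3)[OF this, of "basis_vec \<tau>"] show ?thesis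
      using sym_factor_pos[of \<tau>] sym_factor_pos[of \<sigma>] by (simp add: inner_TT_basis z)
  next
    case False
    then have "z \<notin> Poly_Mapping.keys x" "z \<notin> Poly_Mapping.keys y"
      using assms(1,2) unfolding T_tensor_T_plus_eq z by blast+
    then show ?thesis
      by (simp add: in_keys_iff)
  qed
qed

lemma linear_tensor_left: "linear (\<lambda>f. f \<otimes>\<^sub>T g)"
  and linear_tensor_right: "linear (tensor f)"
  unfolding tensor_def by (rule linear_bilin_ext_left linear_bilin_ext_right)+

text \<open>Both sides are linear in each of the four arguments, which are therefore replaced by
  trees one at a time.\<close>

lemma inner_TT_tensor:
  "inner_TT (f \<otimes>\<^sub>T g) (f' \<otimes>\<^sub>T g') = inner_T f f' * inner_T g g'"
proof -
  have left: "linear (\<lambda>c. c * a)" and right: "linear (\<lambda>c. a * c)" for a :: real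
    by (rule linearI; simp add: algebra_simps)+
  have b: "inner_TT (basis_vec s \<otimes>\<^sub>T basis_vec t) (f' \<otimes>\<^sub>T g') =
      inner_T (basis_vec s) f' * inner_T (basis_vec t) g'"
    for s t :: "('a, 'b, 'c) dtree"
  proof (rule linear_eqI[of "\<lambda>f'. inner_TT (basis_vec s \<otimes>\<^sub>T basis_vec t) (f' \<otimes>\<^sub>T g')"])
    show "inner_TT (basis_vec s \<otimes>\<^sub>T basis_vec t) (basis_vec u \<otimes>\<^sub>T g') =
      inner_T (basis_vec s) (basis_vec u) * inner_T (basis_vec t) g'" for u
    proof (rule linear_eqI[of "\<lambda>g'. inner_TT (basis_vec s \<otimes>\<^sub>T basis_vec t) (basis_vec u \<otimes>\<^sub>T g')"])
    \<comment> \<open>Two linearity claims remain, together with the case of four trees, which is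
      the definition of \<open>inner_TT\<close>.\<close>
    qed (use linear_compose[OF linear_tensor_right linear_inner_TT_right]
          linear_compose[OF linear_inner_T_right right] in \<open>simp_all add: o_def inner_TT_def\<close>)
  qed (use linear_compose[OF linear_tensor_left linear_inner_TT_right]
        linear_compose[OF linear_inner_T_right left] in \<open>simp_all only: o_def\<close>)
  show ?thesis
  proof (rule linear_eqI[of "\<lambda>f. inner_TT (f \<otimes>\<^sub>T g) (f' \<otimes>\<^sub>T g')"])
    show "inner_TT (basis_vec s \<otimes>\<^sub>T g) (f' \<otimes>\<^sub>T g') = inner_T (basis_vec s) f' * inner_T g g'" for s
      by (rule linear_eqI[of "\<lambda>g. inner_TT (basis_vec s \<otimes>\<^sub>T g) (f' \<otimes>\<^sub>T g')", OF _ _ b])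
        (use linear_compose[OF linear_tensor_right linear_inner_TT_left]
          linear_compose[OF linear_inner_T_left right] in \<open>simp_all only: o_def\<close>)
  qed (use linear_compose[OF linear_tensor_left linear_inner_TT_left]
        linear_compose[OF linear_inner_T_left left] in \<open>simp_all only: o_def\<close>)
qed

text \<open>By linearity in \<open>x\<close> it suffices to take a pair of trees; there both
  pairings factor, and the adjoint relation applies in the first factor alone.\<close>

lemma inner_TT_tensor_map_id:
  assumes "is_adjoint R' R"
  shows "inner_TT (\<tau> \<otimes>\<^sub>T \<sigma>) (tensor_map R id x) = inner_TT (R' \<tau> \<otimes>\<^sub>T \<sigma>) x"
proof (rule linear_eqI[OF _ linear_inner_TT_right])
  show "linear (\<lambda>x. inner_TT (\<tau> \<otimes>\<^sub>T \<sigma>) (tensor_map R id x))"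
    using linear_compose[OF linear_lin_ext linear_inner_TT_right]
    unfolding tensor_map_def o_def .
  fix z :: "('a, 'b, 'c) dtree \<times> ('a, 'b, 'c) dtree"
  obtain a b where z: "z = (a, b)" by (cases z)
  have "inner_TT (\<tau> \<otimes>\<^sub>T \<sigma>) (tensor_map R id (basis_vec z)) =
      inner_T \<tau> (R (basis_vec a)) * inner_T \<sigma> (basis_vec b)"
    by (simp add: tensor_map_def z inner_TT_tensor)
  also have "\<dots> = inner_T (R' \<tau>) (basis_vec a) * inner_T \<sigma> (basis_vec b)"
    using assms by (simp add: is_adjoint_def)
  also have "\<dots> = inner_TT (R' \<tau> \<otimes>\<^sub>T \<sigma>) (basis_vec a \<otimes>\<^sub>T basis_vec b)"
    by (rule inner_TT_tensor[symmetric])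
  finally show "inner_TT (\<tau> \<otimes>\<^sub>T \<sigma>) (tensor_map R id (basis_vec z)) =
      inner_TT (R' \<tau> \<otimes>\<^sub>T \<sigma>) (basis_vec z)"
    by (simp add: z)
qed

text \<open>The second tensor factor is untouched, so every term keeps a second tree in
  \<open>plus_trees\<close>.\<close>

lemma tensor_map_id_in_T_tensor_T_plus:
  assumes "x \<in> T_tensor_T_plus \<ss> \<nu> \<kappa>"
  shows "tensor_map R id x \<in> T_tensor_T_plus \<ss> \<nu> \<kappa>"
proof -
  have "R (basis_vec a) \<otimes>\<^sub>T basis_vec b \<in> T_tensor_T_plus \<ss> \<nu> \<kappa>"
    if "(a, b) \<in> Poly_Mapping.keys x" for a b
  proof -
    have "b \<in> plus_trees \<ss> \<nu> \<kappa>"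
      using assms that unfolding T_tensor_T_plus_eq by blast
    then have "basis_vec b \<in> T_plus \<ss> \<nu> \<kappa>"
      by (simp add: T_plus_iff)
    then show ?thesis
      unfolding T_tensor_T_plus_def by (intro span_base) blast
  qed
  then show ?thesis
    unfolding tensor_map_def lin_ext_def T_tensor_T_plus_def
    by (intro span_sum span_scale) auto
qed

theorem proposition3:
  fixes \<ss> :: "nat ^ 'i::finite"
    and \<nu> :: "'n::finite \<Rightarrow> real"
    and \<kappa> :: "'k::finite \<Rightarrow> real"
    and R R' :: "('i, 'n, 'k) T \<Rightarrow> ('i, 'n, 'k) T"
  assumes "CARD('i) \<ge> 2"
    and "\<And>r. \<ss> $ r > 0"
    and "\<And>j. \<nu> j < 0"
    and "\<And>t. \<kappa> t > 0"
    and "linear R"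
    and "is_adjoint R' R"
  shows "(\<forall>\<mu>. tensor_map R id (splitting \<ss> \<nu> \<kappa> \<mu>) = splitting \<ss> \<nu> \<kappa> (R \<mu>)) \<longleftrightarrow>
    (\<forall>\<sigma>\<in>T_plus \<ss> \<nu> \<kappa>. \<forall>\<tau>. R' (\<sigma> \<star> \<tau>) = \<sigma> \<star> R' \<tau>)"
proof -
  let ?D = "splitting \<ss> \<nu> \<kappa>"
  have "is_splitting \<ss> \<nu> \<kappa> ?D"
    using is_splitting_splitting[of \<ss> \<nu> \<kappa>, OF assms(2,3)] .
  then have range: "?D \<mu> \<in> T_tensor_T_plus \<ss> \<nu> \<kappa>"
    and duality: "\<sigma> \<in> T_plus \<ss> \<nu> \<kappa> \<Longrightarrow> inner_TT (\<tau> \<otimes>\<^sub>T \<sigma>) (?D \<mu>) = inner_T (\<sigma> \<star> \<tau>) \<mu>" for \<sigma> \<tau> \<mu>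
    unfolding is_splitting_def by auto
  \<comment> \<open>Here \<open>duality\<close> is used with \<open>R' \<tau>\<close> as its right
    factor, and in \<open>rhs\<close> with \<open>R \<mu>\<close> as the argument of the splitting
    map.\<close>
  have lhs: "inner_TT (\<tau> \<otimes>\<^sub>T \<sigma>) (tensor_map R id (?D \<mu>)) = inner_T (\<sigma> \<star> R' \<tau>) \<mu>"
    if "\<sigma> \<in> T_plus \<ss> \<nu> \<kappa>" for \<sigma> \<tau> \<mu>
    using that by (simp add: inner_TT_tensor_map_id[OF assms(6)] duality)
  have rhs: "inner_TT (\<tau> \<otimes>\<^sub>T \<sigma>) (?D (R \<mu>)) = inner_T (R' (\<sigma> \<star> \<tau>)) \<mu>"
    if "\<sigma> \<in> T_plus \<ss> \<nu> \<kappa>" for \<sigma> \<tau> \<mu>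
    using that assms(6) by (simp add: duality is_adjoint_def)
  show ?thesis
  proof (intro iffI allI ballI)
    fix \<sigma> \<tau>
    assume "\<forall>\<mu>. tensor_map R id (?D \<mu>) = ?D (R \<mu>)" and "\<sigma> \<in> T_plus \<ss> \<nu> \<kappa>"
    then show "R' (\<sigma> \<star> \<tau>) = \<sigma> \<star> R' \<tau>"
      using lhs rhs by (intro inner_T_nondegenerate) metis
  next
    fix \<mu>
    assume "\<forall>\<sigma>\<in>T_plus \<ss> \<nu> \<kappa>. \<forall>\<tau>. R' (\<sigma> \<star> \<tau>) = \<sigma> \<star> R' \<tau>"
    \<comment> \<open>For each \<open>\<sigma>\<close> in \<open>T_plus\<close>, \<open>lhs\<close>
      and \<open>rhs\<close> turn the two pairings into those of the assumed equal vectors with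
      \<open>\<mu>\<close>.\<close>
    then show "tensor_map R id (?D \<mu>) = ?D (R \<mu>)"
      by (intro inner_TT_nondegenerate_plus[OF tensor_map_id_in_T_tensor_T_plus[OF range] range])
        (simp add: lhs rhs)
  qed
qed

end
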